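(* Let $\mathcal{X}$ be an $N$-order tensor with all mode lengths equal to $I$ and with set of observable entries $\Omega$, and let the core tensor have all mode lengths equal to $J$. Then the memory complexity of the P-Tucker-Cache algorithm, i.e. the space required for its intermediate data, is $O(|\Omega|J^N)$.
   Context: Intermediate data means the memory required for updating the factor matrices, excluding the memory for storing the input tensor $\mathcal{X}$, the core tensor $\mathcal{G}$ and the factor matrices $\mathbf{A}^{(n)}$ themselves. Data: tensor $\mathcal{X}$ with observable index tuples $\Omega\subseteq\{1,\dots,I\}^N$, factor matrices $\mathbf{A}^{(n)}=(a^{(n)}_{ij})\in\mathbb{R}^{I\times J}$ ($n=1,\dots,N$), core tensor $\mathcal{G}\in\mathbb{R}^{J\times\cdots\times J}$ of order $N$, regularization parameter $\lambda>0$. $\Omega^{(n)}_{i_n}$ is the set of tuples in $\Omega$ with $n$th coordinate $i_n$. P-Tucker-Cache maintains a cache table $Pres\in\mathbb{R}^{|\Omega|\times J^N}$ with $Pres[\alpha][\beta]=\mathcal{G}_\beta\prod_{k=1}^N a^{(k)}_{i_kj_k}$ for $\alpha=(i_1,\dots,i_N)\in\Omega$ and $\beta=(j_1,\dots,j_N)\in\{1,\dots,J\}^N$. Updating factor matrices in P-Tucker-Cache: first compute $Pres$. Then for each $n=1,\dots,N$: for each row $i_n$ (rows are distributed over threads, and per-row data is released after each row update) and each $\alpha\in\Omega^{(n)}_{i_n}$, compute $\delta^{(n)}_\alpha\in\mathbb{R}^J$ by looping over all $\beta=(j_1,\dots,j_N)$ and adding $Pres[\alpha][\beta]/a^{(n)}_{i_nj_n}$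 to $\delta^{(n)}_\alpha(j_n)$; accumulate $\mathbf{B}^{(n)}_{i_n}\in\mathbb{R}^{J\times J}$, with entries $\sum_{\alpha\in\Omega^{(n)}_{i_n}}\delta^{(n)}_\alpha(j)\delta^{(n)}_\alpha(j')$, and $\mathbf{c}^{(n)}_{i_n:}\in\mathbb{R}^J$, with entries $\sum_{\alpha\in\Omega^{(n)}_{i_n}}\mathcal{X}_\alpha\delta^{(n)}_\alpha(j)$; replace the $i_n$th row of $\mathbf{A}^{(n)}$ by $\mathbf{c}^{(n)}_{i_n:}[\mathbf{B}^{(n)}_{i_n}+\lambda\mathbf{I}_J]^{-1}$. After all rows of $\mathbf{A}^{(n)}$ are updated, update $Pres[\alpha][\beta]\leftarrow \bigl(Pres[\alpha][\beta]/(\text{old }a^{(n)}_{i_nj_n})\bigr)\cdot(\text{new }a^{(n)}_{i_nj_n})$ for all $\alpha,\beta$. (When the divisor is $0$, the needed product is computed by direct multiplication instead.) In the paper's accounting, the size of the cache table dominates that of the other intermediate data ($\delta^{(n)}_\alpha$, $\mathbf{c}^{(n)}_{i_n:}$, $\mathbf{B}^{(n)}_{i_n}$ and the inverse matrix, held per thread). *)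

theory Defs
  imports Complex_Main "HOL-Library.Extended_Nat" "Jordan_Normal_Form.Matrix"
begin

text \<open>
  Modes, rows and columns are numbered from 0. An index tuple is a list of natural numbers;
  the \<open>n\<close>-th coordinate of \<open>\<alpha>\<close> is \<open>\<alpha> ! n\<close>.
\<close>

definition index_tuples :: "nat \<Rightarrow> nat \<Rightarrow> nat list set" where
  "index_tuples N D = {xs. length xs = N \<and> set xs \<subseteq> {..<D}}"

record tucker_input =
  tensor_order :: nat                               \<comment> \<open>\<open>N\<close>\<close>
  mode_len :: nat                                   \<comment> \<open>\<open>I\<close>\<close>
  core_len :: nat                                   \<comment> \<open>\<open>J\<close>\<close>
  observed :: "nat list set"                        \<comment> \<open>\<open>\<Omega>\<close>\<close>
  tensor_entry :: "nat list \<Rightarrow> real"                \<comment> \<open>\<open>X\<close>, used on \<open>\<Omega>\<close> only\<close>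
  core_entry :: "nat list \<Rightarrow> real"                  \<comment> \<open>\<open>G\<close>\<close>
  init_factors :: "nat \<Rightarrow> nat \<Rightarrow> nat \<Rightarrow> real"      \<comment> \<open>mode, row, column\<close>
  reg_param :: real                                 \<comment> \<open>\<open>\<lambda>\<close>\<close>
  num_threads :: nat                                \<comment> \<open>\<open>T\<close>\<close>

definition valid_input :: "tucker_input \<Rightarrow> bool" where
  "valid_input P \<longleftrightarrow>
     tensor_order P \<ge> 1 \<and> mode_len P \<ge> 1 \<and> core_len P \<ge> 1 \<and> num_threads P \<ge> 1 \<and>
     reg_param P > 0 \<and> observed P \<subseteq> index_tuples (tensor_order P) (mode_len P)"

definition core_tuples :: "tucker_input \<Rightarrow> nat list set" where
  "core_tuples P = index_tuples (tensor_order P) (core_len P)"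

definition slice :: "tucker_input \<Rightarrow> nat \<Rightarrow> nat \<Rightarrow> nat list set" where
  "slice P n i = {\<alpha> \<in> observed P. \<alpha> ! n = i}"

definition cache_value ::
    "tucker_input \<Rightarrow> (nat \<Rightarrow> nat \<Rightarrow> nat \<Rightarrow> real) \<Rightarrow> nat list \<Rightarrow> nat list \<Rightarrow> real" where
  "cache_value P A \<alpha> \<beta> = core_entry P \<beta> * (\<Prod>k<tensor_order P. A k (\<alpha> ! k) (\<beta> ! k))"

definition cache_value_without ::
    "tucker_input \<Rightarrow> (nat \<Rightarrow> nat \<Rightarrow> nat \<Rightarrow> real) \<Rightarrow> nat \<Rightarrow> nat list \<Rightarrow> nat list \<Rightarrow> real" where
  "cache_value_without P A n \<alpha> \<beta> =
     core_entry P \<beta> * (\<Prod>k\<in>{..<tensor_order P} - {n}. A k (\<alpha> ! k) (\<beta> ! k))"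

text \<open>
  The intermediate data live in a memory that maps each allocated address to one real number.
  The input tensor, the core tensor and the factor matrices are kept outside this memory and
  are not counted. The old entries of the matrix being updated, which are needed
  to rescale the cache table, are kept inside the memory and therefore are counted.
\<close>

datatype addr =
    Pres "nat list" "nat list"
  | OldEntry nat nat          \<comment> \<open>row, column\<close>
  | Delta nat nat             \<comment> \<open>thread, index: \<open>\<delta>\<close>\<close>
  | CVec nat nat              \<comment> \<open>thread, index: \<open>c\<close>\<close>
  | BMat nat nat nat          \<comment> \<open>thread, row, column: \<open>B\<close>, then \<open>B + \<lambda>I\<close> in place\<close>
  | Inv nat nat nat           \<comment> \<open>thread, row, column: inverse of \<open>B + \<lambda>I\<close>\<close>

type_synonym memory = "addr \<rightharpoonup> real"

text \<open>Number of allocated words.\<close>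

definition mem_size :: "memory \<Rightarrow> enat" where
  "mem_size m = (if finite (dom m) then enat (card (dom m)) else \<infinity>)"

text \<open>Write \<open>f a\<close> to every address \<open>a \<in> S\<close>, allocating the addresses not yet in use.\<close>

definition store :: "addr set \<Rightarrow> (addr \<Rightarrow> real) \<Rightarrow> memory \<Rightarrow> memory" where
  "store S f m = (\<lambda>a. if a \<in> S then Some (f a) else m a)"

definition release :: "addr set \<Rightarrow> memory \<Rightarrow> memory" where
  "release S m = m |` (- S)"

definition load :: "memory \<Rightarrow> addr \<Rightarrow> real" where
  "load m a = the (m a)"

definition delta_block :: "tucker_input \<Rightarrow> nat \<Rightarrow> addr set" where
  "delta_block P t = {Delta t j | j. j < core_len P}"

definition c_block :: "tucker_input \<Rightarrow> nat \<Rightarrow> addr set" where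
  "c_block P t = {CVec t j | j. j < core_len P}"

definition B_block :: "tucker_input \<Rightarrow> nat \<Rightarrow> addr set" where
  "B_block P t = {BMat t j j' | j j'. j < core_len P \<and> j' < core_len P}"

definition B_diagonal :: "tucker_input \<Rightarrow> nat \<Rightarrow> addr set" where
  "B_diagonal P t = {BMat t j j | j. j < core_len P}"

definition inv_block :: "tucker_input \<Rightarrow> nat \<Rightarrow> addr set" where
  "inv_block P t = {Inv t j j' | j j'. j < core_len P \<and> j' < core_len P}"

definition thread_block :: "tucker_input \<Rightarrow> nat \<Rightarrow> addr set" where
  "thread_block P t = delta_block P t \<union> c_block P t \<union> B_block P t \<union> inv_block P t"

definition old_row_block :: "tucker_input \<Rightarrow> nat \<Rightarrow> addr set" where
  "old_row_block P i = {OldEntry i j | j. j < core_len P}"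

text \<open>
  Control state. The set arguments hold the loop indices still to be processed; loops visit
  their index set in arbitrary order.
\<close>

datatype phase =
    Caching "(nat list \<times> nat list) set"
  | Updating nat "nat set"                          \<comment> \<open>mode, rows not yet given to a thread\<close>
  | Rescaling nat "(nat list \<times> nat list) set"
  | Finished

datatype worker =
    Idle
  | Gathering nat "nat list set"                              \<comment> \<open>row, remaining \<open>\<alpha>\<close>\<close>
  | Building nat "nat list set" "nat list" "nat list set"     \<comment> \<open>row, remaining \<open>\<alpha>\<close>,
                                                                   current \<open>\<alpha>\<close>, remaining \<open>\<beta>\<close>\<close>
  | Regularized nat
  | Inverted nat
  | Replaced nat

record state =
  phase :: phase
  workers :: "nat \<Rightarrow> worker"
  factors :: "nat \<Rightarrow> nat \<Rightarrow> nat \<Rightarrow> real"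
  mem :: memory

definition initial_state :: "tucker_input \<Rightarrow> state" where
  "initial_state P =
     \<lparr> phase = Caching (observed P \<times> core_tuples P), workers = (\<lambda>t. Idle),
       factors = init_factors P, mem = Map.empty \<rparr>"

definition delta_summand ::
    "tucker_input \<Rightarrow> state \<Rightarrow> nat \<Rightarrow> nat list \<Rightarrow> nat list \<Rightarrow> real" where
  "delta_summand P s n \<alpha> \<beta> =
     (let a = factors s n (\<alpha> ! n) (\<beta> ! n) in
      if a = 0 then cache_value_without P (factors s) n \<alpha> \<beta>
      else load (mem s) (Pres \<alpha> \<beta>) / a)"

definition rescaled_value ::
    "tucker_input \<Rightarrow> state \<Rightarrow> nat \<Rightarrow> nat list \<Rightarrow> nat list \<Rightarrow> real" where
  "rescaled_value P s n \<alpha> \<beta> =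
     (let old = load (mem s) (OldEntry (\<alpha> ! n) (\<beta> ! n)) in
      if old = 0 then cache_value P (factors s) \<alpha> \<beta>
      else load (mem s) (Pres \<alpha> \<beta>) / old * factors s n (\<alpha> ! n) (\<beta> ! n))"

definition accumulate :: "tucker_input \<Rightarrow> nat \<Rightarrow> nat list \<Rightarrow> memory \<Rightarrow> memory" where
  "accumulate P t \<alpha> m =
     store (B_block P t \<union> c_block P t)
       (\<lambda>a. case a of
              BMat t j j' \<Rightarrow> load m a + load m (Delta t j) * load m (Delta t j')
            | CVec t j \<Rightarrow> load m a + tensor_entry P \<alpha> * load m (Delta t j)
            | _ \<Rightarrow> 0) m"

definition B_matrix :: "tucker_input \<Rightarrow> nat \<Rightarrow> memory \<Rightarrow> real mat" where
  "B_matrix P t m = mat (core_len P) (core_len P) (\<lambda>(j, j'). load m (BMat t j j'))"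

definition new_row :: "tucker_input \<Rightarrow> nat \<Rightarrow> memory \<Rightarrow> (nat \<Rightarrow> real) \<Rightarrow> nat \<Rightarrow> real" where
  "new_row P t m r =
     (\<lambda>j. if j < core_len P then \<Sum>k<core_len P. load m (CVec t k) * load m (Inv t k j)
          else r j)"

text \<open>
  One step of an arbitrary interleaving of the threads. A row may be taken by any idle thread,
  so every distribution of the rows over the threads is covered.
\<close>

inductive step :: "tucker_input \<Rightarrow> state \<Rightarrow> state \<Rightarrow> bool" for P where
  cache_entry:
    "phase s = Caching R \<Longrightarrow> (\<alpha>, \<beta>) \<in> R \<Longrightarrow>
     step P s (s\<lparr> phase := Caching (R - {(\<alpha>, \<beta>)}),
                 mem := (mem s)(Pres \<alpha> \<beta> \<mapsto> cache_value P (factors s) \<alpha> \<beta>) \<rparr>)"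
| cache_complete:
    "phase s = Caching {} \<Longrightarrow>
     step P s (s\<lparr> phase := Updating 0 {..<mode_len P} \<rparr>)"
| start_row:
    "phase s = Updating n R \<Longrightarrow> i \<in> R \<Longrightarrow> t < num_threads P \<Longrightarrow> workers s t = Idle \<Longrightarrow>
     step P s (s\<lparr> phase := Updating n (R - {i}),
                 workers := (workers s)(t := Gathering i (slice P n i)),
                 mem := store (B_block P t \<union> c_block P t) (\<lambda>_. 0) (mem s) \<rparr>)"
| start_delta:
    "phase s = Updating n R \<Longrightarrow> t < num_threads P \<Longrightarrow> workers s t = Gathering i S \<Longrightarrow> \<alpha> \<in> S \<Longrightarrow>
     step P s (s\<lparr> workers := (workers s)(t := Building i (S - {\<alpha>}) \<alpha> (core_tuples P)),
                 mem := store (delta_block P t) (\<lambda>_. 0) (mem s) \<rparr>)"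
| add_to_delta:
    "phase s = Updating n R \<Longrightarrow> t < num_threads P \<Longrightarrow> workers s t = Building i S \<alpha> Q \<Longrightarrow> \<beta> \<in> Q \<Longrightarrow>
     step P s (s\<lparr> workers := (workers s)(t := Building i S \<alpha> (Q - {\<beta>})),
                 mem := (mem s)(Delta t (\<beta> ! n) \<mapsto>
                   load (mem s) (Delta t (\<beta> ! n)) + delta_summand P s n \<alpha> \<beta>) \<rparr>)"
| finish_delta:
    "phase s = Updating n R \<Longrightarrow> t < num_threads P \<Longrightarrow> workers s t = Building i S \<alpha> {} \<Longrightarrow>
     step P s (s\<lparr> workers := (workers s)(t := Gathering i S),
                 mem := accumulate P t \<alpha> (mem s) \<rparr>)"
| regularize:
    "phase s = Updating n R \<Longrightarrow> t < num_threads P \<Longrightarrow> workers s t = Gathering i {} \<Longrightarrow>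
     step P s (s\<lparr> workers := (workers s)(t := Regularized i),
                 mem := store (B_diagonal P t) (\<lambda>a. load (mem s) a + reg_param P) (mem s) \<rparr>)"
| invert:
    "phase s = Updating n R \<Longrightarrow> t < num_threads P \<Longrightarrow> workers s t = Regularized i \<Longrightarrow>
     V \<in> carrier_mat (core_len P) (core_len P) \<Longrightarrow>
     inverts_mat (B_matrix P t (mem s)) V \<Longrightarrow> inverts_mat V (B_matrix P t (mem s)) \<Longrightarrow>
     step P s (s\<lparr> workers := (workers s)(t := Inverted i),
                 mem := store (inv_block P t)
                   (\<lambda>a. case a of Inv t j j' \<Rightarrow> V $$ (j, j') | _ \<Rightarrow> 0) (mem s) \<rparr>)"
  \<comment> \<open>Only old rows that occur in some observed tuple are read again.\<close>
| replace_row: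
    "phase s = Updating n R \<Longrightarrow> t < num_threads P \<Longrightarrow> workers s t = Inverted i \<Longrightarrow>
     step P s (s\<lparr> workers := (workers s)(t := Replaced i),
                 factors := (factors s)(n :=
                   (factors s n)(i := new_row P t (mem s) (factors s n i))),
                 mem := store (if slice P n i = {} then {} else old_row_block P i)
                   (\<lambda>a. case a of OldEntry i j \<Rightarrow> factors s n i j | _ \<Rightarrow> 0) (mem s) \<rparr>)"
| release_row:
    "phase s = Updating n R \<Longrightarrow> t < num_threads P \<Longrightarrow> workers s t = Replaced i \<Longrightarrow>
     step P s (s\<lparr> workers := (workers s)(t := Idle),
                 mem := release (thread_block P t) (mem s) \<rparr>)"
| start_rescaling:
    "phase s = Updating n {} \<Longrightarrow> (\<And>t. t < num_threads P \<Longrightarrow> workers s t = Idle) \<Longrightarrow>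
     step P s (s\<lparr> phase := Rescaling n (observed P \<times> core_tuples P) \<rparr>)"
| rescale_entry:
    "phase s = Rescaling n R \<Longrightarrow> (\<alpha>, \<beta>) \<in> R \<Longrightarrow>
     step P s (s\<lparr> phase := Rescaling n (R - {(\<alpha>, \<beta>)}),
                 mem := (mem s)(Pres \<alpha> \<beta> \<mapsto> rescaled_value P s n \<alpha> \<beta>) \<rparr>)"
| finish_mode:
    "phase s = Rescaling n {} \<Longrightarrow>
     step P s (s\<lparr> phase := (if Suc n < tensor_order P then Updating (Suc n) {..<mode_len P}
                           else Finished),
                 mem := release (\<Union>i<mode_len P. old_row_block P i) (mem s) \<rparr>)"

text \<open>Largest number of simultaneously allocated words over all executions.\<close>

definition memory_requirement :: "tucker_input \<Rightarrow> enat" where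
  "memory_requirement P = (SUP s\<in>{s. (step P)\<^sup>*\<^sup>* (initial_state P) s}. mem_size (mem s))"

definition cache_table_size :: "tucker_input \<Rightarrow> nat" where
  "cache_table_size P = card (observed P) * core_len P ^ tensor_order P"

text \<open>Per thread: \<open>\<delta>\<close> and \<open>c\<close> of length \<open>J\<close>, \<open>B\<close> and the inverse of size \<open>J \<times> J\<close>.\<close>

definition thread_data_size :: "tucker_input \<Rightarrow> nat" where
  "thread_data_size P = num_threads P * (2 * core_len P + 2 * core_len P ^ 2)"

definition cache_dominates :: "nat \<Rightarrow> tucker_input \<Rightarrow> bool" where
  "cache_dominates K P \<longleftrightarrow> thread_data_size P \<le> K * cache_table_size P"

text \<open>
  For a bounded number of threads, order at least 2 and some observed entry, the cache table
  dominates automatically.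
\<close>

lemma cache_dominates_if_order_ge_2:
  assumes "valid_input P" "tensor_order P \<ge> 2" "observed P \<noteq> {}" "num_threads P \<le> T"
  shows "cache_dominates (4 * T) P"
proof -
  let ?J = "core_len P"
  have "finite (index_tuples (tensor_order P) (mode_len P))"
    using finite_lists_length_eq[of "{..<mode_len P}" "tensor_order P"]
    by (simp add: index_tuples_def conj_commute)
  then have "finite (observed P)"
    using assms(1) finite_subset by (auto simp: valid_input_def)
  then have obs: "1 \<le> card (observed P)"
    using assms(3) by (simp add: Suc_le_eq card_gt_0_iff)
  have J: "1 \<le> ?J"
    using assms(1) by (simp add: valid_input_def)
  then have pow: "?J ^ 2 \<le> ?J ^ tensor_order P"
    using assms(2) by (rule power_increasing[rotated])
  have "?J \<le> ?J ^ 2"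
    using J by (simp add: power2_eq_square)
  then have "2 * ?J + 2 * ?J ^ 2 \<le> 4 * ?J ^ tensor_order P"
    using pow by linarith
  also have "\<dots> \<le> 4 * cache_table_size P"
    using obs by (simp add: cache_table_size_def)
  finally have "thread_data_size P \<le> T * (4 * cache_table_size P)"
    unfolding thread_data_size_def using assms(4) by (rule mult_le_mono[rotated])
  then show ?thesis
    by (simp add: cache_dominates_def algebra_simps)
qed

end

theory Submission
  imports Defs
begin

text \<open>
  At every moment the allocated addresses lie in the cache table, the blocks of the threads and
  the old rows of the mode being updated. Only rows that meet \<open>\<Omega>\<close> are kept, so there are at most
  \<open>|\<Omega>|\<close> of them, of \<open>J \<le> J\<^sup>N\<close> words each; since they are released before the next mode starts, the
  modes do not add up. With the thread data bounded by \<open>K\<close> cache tables, \<open>C = K + 2\<close> works.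
\<close>

section \<open>Domains of memories and finiteness of index sets\<close>

lemma dom_store [simp]: "dom (store S f m) = S \<union> dom m"
  by (auto simp: store_def dom_def)

lemma dom_release [simp]: "dom (release S m) = dom m - S"
  by (auto simp: release_def)

lemma finite_index_tuples: "finite (index_tuples N D)"
  using finite_lists_length_eq[of "{..<D}" N] by (simp add: index_tuples_def conj_commute)

lemma card_index_tuples: "card (index_tuples N D) = D ^ N"
  using card_lists_length_eq[of "{..<D}" N] by (simp add: index_tuples_def conj_commute)

lemma nth_index_tuples: "xs \<in> index_tuples N D \<Longrightarrow> n < N \<Longrightarrow> xs ! n < D"
  by (auto simp: index_tuples_def subset_iff)

lemma finite_observed: "valid_input P \<Longrightarrow> finite (observed P)"
  by (meson valid_input_def finite_index_tuples finite_subset)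

section \<open>The invariant: allocated addresses stay inside the footprint of the phase\<close>

definition cache_block :: "tucker_input \<Rightarrow> addr set" where
  "cache_block P = (\<lambda>(\<alpha>, \<beta>). Pres \<alpha> \<beta>) ` (observed P \<times> core_tuples P)"

text \<open>Upper bound on the rows with stored old entries: it depends on the mode, not on how far
  the row loop has come. It is empty outside mode updates, so the invariant forces the old rows to
  be gone when a mode ends.\<close>

fun saved_rows :: "tucker_input \<Rightarrow> phase \<Rightarrow> nat set" where
  "saved_rows P (Caching R) = {}"
| "saved_rows P (Updating n R) = {i. slice P n i \<noteq> {}}"
| "saved_rows P (Rescaling n R) = {i. slice P n i \<noteq> {}}"
| "saved_rows P Finished = {}"

definition footprint :: "tucker_input \<Rightarrow> phase \<Rightarrow> addr set" where
  "footprint P p = cache_block P \<union> (\<Union>t<num_threads P. thread_block P t) \<union>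
     (\<Union>i\<in>saved_rows P p. old_row_block P i)"

text \<open>Keeps the addresses computed from loop indices in range: pairs still to be processed
  name cells of the cache table, and \<open>n < tensor_order P\<close> bounds the coordinates
  \<open>\<alpha> ! n\<close> and \<open>\<beta> ! n\<close>.\<close>

fun phase_ok :: "tucker_input \<Rightarrow> phase \<Rightarrow> bool" where
  "phase_ok P (Caching R) \<longleftrightarrow> R \<subseteq> observed P \<times> core_tuples P"
| "phase_ok P (Updating n R) \<longleftrightarrow> n < tensor_order P"
| "phase_ok P (Rescaling n R) \<longleftrightarrow> n < tensor_order P \<and> R \<subseteq> observed P \<times> core_tuples P"
| "phase_ok P Finished \<longleftrightarrow> True"

fun worker_ok :: "tucker_input \<Rightarrow> worker \<Rightarrow> bool" where
  "worker_ok P (Building i S \<alpha> Q) \<longleftrightarrow> Q \<subseteq> core_tuples P"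
| "worker_ok P _ \<longleftrightarrow> True"

text \<open>Only the domain of the memory is constrained, since the stored values do not affect its
  size.\<close>

definition state_ok :: "tucker_input \<Rightarrow> state \<Rightarrow> bool" where
  "state_ok P s \<longleftrightarrow> phase_ok P (phase s) \<and> (\<forall>t. worker_ok P (workers s t)) \<and>
     dom (mem s) \<subseteq> footprint P (phase s)"

lemma saved_rows_less_mode_len:
  assumes "valid_input P" "phase_ok P p"
  shows "saved_rows P p \<subseteq> {..<mode_len P}"
  using assms by (cases p) (auto simp: valid_input_def slice_def dest!: subsetD dest: nth_index_tuples)

lemma card_saved_rows:
  assumes "valid_input P"
  shows "finite (saved_rows P p)" "card (saved_rows P p) \<le> card (observed P)"
proof -
  \<comment> \<open>A saved row is the coordinate in mode \<open>n\<close> of some observed tuple;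
    in phases without saved rows any \<open>n\<close> serves.\<close>
  obtain n where "saved_rows P p \<subseteq> (\<lambda>\<alpha>. \<alpha> ! n) ` observed P"
    by (cases p) (fastforce simp: slice_def)+
  then show "finite (saved_rows P p)" "card (saved_rows P p) \<le> card (observed P)"
    using finite_observed[OF assms] by (auto intro: finite_subset surj_card_le)
qed

lemma thread_block_subset_footprint:
  "t < num_threads P \<Longrightarrow> thread_block P t \<subseteq> footprint P p"
  by (auto simp: footprint_def)

lemma saved_row_block_subset_footprint:
  "i \<in> saved_rows P p \<Longrightarrow> old_row_block P i \<subseteq> footprint P p"
  by (auto simp: footprint_def)

text \<open>All saved rows are below \<open>mode_len P\<close>, so the release at the end of a mode
  leaves only the cache and thread blocks. These are common to all phases, so \<open>q\<close> may
  be the next mode or \<open>Finished\<close>.\<close>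

lemma footprint_minus_old_rows:
  assumes "valid_input P" "phase_ok P p"
  shows "footprint P p - (\<Union>i<mode_len P. old_row_block P i) \<subseteq> footprint P q"
  using saved_rows_less_mode_len[OF assms] by (auto simp: footprint_def)

lemma state_ok_initial: "state_ok P (initial_state P)"
  by (simp add: state_ok_def initial_state_def)

lemma state_ok_step:
  assumes "valid_input P" "step P s s'" "state_ok P s"
  shows "state_ok P s'"
  using assms(2,3)
proof cases
  case (cache_entry R \<alpha> \<beta>)
  then show ?thesis
    using assms(3) by (auto simp: state_ok_def footprint_def cache_block_def)
next
  case cache_complete
  \<comment> \<open>Mode 0 exists because the order is at least 1; the footprint can only grow
    here.\<close>
  then show ?thesis
    using assms(1,3) by (auto simp: state_ok_def valid_input_def footprint_def)
next
  case (start_row n R i t)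
  then show ?thesis
    using assms(3) thread_block_subset_footprint[of t P "phase s"]
    by (auto simp: state_ok_def thread_block_def footprint_def)
next
  case (start_delta n R t i S \<alpha>)
  then show ?thesis
    using assms(3) thread_block_subset_footprint[of t P "phase s"]
    by (auto simp: state_ok_def thread_block_def)
next
  case (add_to_delta n R t i S \<alpha> Q \<beta>)
  \<comment> \<open>The written index \<open>\<beta> ! n\<close> must be shown to lie inside the
    block of \<open>\<delta>\<close>.\<close>
  have "worker_ok P (workers s t)" "n < tensor_order P"
    using assms(3) add_to_delta by (metis state_ok_def phase_ok.simps(2))+
  then have "Q \<subseteq> core_tuples P" "\<beta> ! n < core_len P"
    using add_to_delta by (auto simp: core_tuples_def intro: nth_index_tuples)
  then have "Delta t (\<beta> ! n) \<in> thread_block P t"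
    by (auto simp: thread_block_def delta_block_def)
  then show ?thesis
    using assms(3) add_to_delta thread_block_subset_footprint[of t P "phase s"] \<open>Q \<subseteq> core_tuples P\<close>
    by (auto simp: state_ok_def)
next
  case (finish_delta n R t i S \<alpha>)
  then show ?thesis
    using assms(3) thread_block_subset_footprint[of t P "phase s"]
    by (auto simp: state_ok_def thread_block_def accumulate_def)
next
  case (regularize n R t i)
  moreover have "B_diagonal P t \<subseteq> thread_block P t"
    by (auto simp: B_diagonal_def thread_block_def B_block_def)
  ultimately show ?thesis
    using assms(3) thread_block_subset_footprint[of t P "phase s"]
    by (auto simp: state_ok_def)
next
  case (invert n R t i V)
  then show ?thesis
    using assms(3) thread_block_subset_footprint[of t P "phase s"]
    by (auto simp: state_ok_def thread_block_def)
next
  case (replace_row n R t i)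
  \<comment> \<open>Either the slice is empty and nothing is stored, or \<open>i\<close> is a saved
    row of the current mode.\<close>
  then show ?thesis
    using assms(3) saved_row_block_subset_footprint[of i P "phase s"]
    by (auto simp: state_ok_def)
next
  case (release_row n R t i)
  then show ?thesis
    using assms(3) by (auto simp: state_ok_def)
next
  case (start_rescaling n)
  then show ?thesis
    using assms(3) by (auto simp: state_ok_def footprint_def)
next
  case (rescale_entry n R \<alpha> \<beta>)
  then show ?thesis
    using assms(3) by (auto simp: state_ok_def footprint_def cache_block_def)
next
  case (finish_mode n)
  have ok: "phase_ok P (phase s)" "dom (mem s) \<subseteq> footprint P (phase s)"
    using assms(3) by (simp_all add: state_ok_def)
  have "dom (mem s') = dom (mem s) - (\<Union>i<mode_len P. old_row_block P i)"
    using finish_mode by simp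
  also have "\<dots> \<subseteq> footprint P (phase s')"
    using footprint_minus_old_rows[OF assms(1) ok(1)] by (rule order.trans[OF Diff_mono[OF ok(2) order.refl]])
  finally show ?thesis
    using assms(3) finish_mode by (simp add: state_ok_def)
qed

lemma state_ok_reachable:
  assumes "valid_input P" "(step P)\<^sup>*\<^sup>* (initial_state P) s"
  shows "state_ok P s"
  using assms(2) by induction (auto intro: state_ok_initial state_ok_step[OF assms(1)])

section \<open>Counting the addresses of the footprint\<close>

lemma card_cache_block:
  assumes "valid_input P"
  shows "finite (cache_block P)" "card (cache_block P) \<le> cache_table_size P"
proof -
  have "finite (observed P \<times> core_tuples P)"
    using finite_observed[OF assms] by (simp add: core_tuples_def finite_index_tuples)
  then show "finite (cache_block P)" "card (cache_block P) \<le> cache_table_size P"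
    unfolding cache_block_def cache_table_size_def
    by (auto intro: order.trans[OF card_image_le]
        simp: card_cartesian_product core_tuples_def card_index_tuples)
qed

lemma card_thread_block:
  "finite (thread_block P t)" "card (thread_block P t) \<le> 2 * core_len P + 2 * core_len P ^ 2"
proof -
  let ?J = "{..<core_len P}"
  have blocks:
    "delta_block P t = Delta t ` ?J" "c_block P t = CVec t ` ?J"
    "B_block P t = (\<lambda>(j, j'). BMat t j j') ` (?J \<times> ?J)"
    "inv_block P t = (\<lambda>(j, j'). Inv t j j') ` (?J \<times> ?J)"
    by (auto simp: delta_block_def c_block_def B_block_def inv_block_def)
  show "finite (thread_block P t)"
    by (simp add: thread_block_def blocks)
  have "card (delta_block P t) \<le> core_len P" "card (c_block P t) \<le> core_len P"
    "card (B_block P t) \<le> core_len P ^ 2" "card (inv_block P t) \<le> core_len P ^ 2"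
    unfolding blocks
    by (auto intro: order.trans[OF card_image_le] simp: card_cartesian_product power2_eq_square)
  then show "card (thread_block P t) \<le> 2 * core_len P + 2 * core_len P ^ 2"
    unfolding thread_block_def
    using card_Un_le[of "delta_block P t \<union> c_block P t \<union> B_block P t" "inv_block P t"]
      card_Un_le[of "delta_block P t \<union> c_block P t" "B_block P t"]
      card_Un_le[of "delta_block P t" "c_block P t"]
    by linarith
qed

lemma card_old_row_block: "finite (old_row_block P i)" "card (old_row_block P i) \<le> core_len P"
proof -
  have "old_row_block P i = OldEntry i ` {..<core_len P}"
    by (auto simp: old_row_block_def)
  then show "finite (old_row_block P i)" "card (old_row_block P i) \<le> core_len P"
    using card_image_le[of "{..<core_len P}" "OldEntry i"] by auto
qed

lemma card_footprint:
  assumes "valid_input P"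
  shows "finite (footprint P p)"
    "card (footprint P p) \<le> 2 * cache_table_size P + thread_data_size P"
proof -
  let ?threads = "\<Union>t<num_threads P. thread_block P t"
  let ?rows = "\<Union>i\<in>saved_rows P p. old_row_block P i"
  show "finite (footprint P p)"
    using assms
    by (simp add: footprint_def card_cache_block card_thread_block card_saved_rows card_old_row_block)
  have "card ?threads \<le> (\<Sum>t<num_threads P. card (thread_block P t))"
    by (rule card_UN_le) simp
  also have "\<dots> \<le> thread_data_size P"
    using sum_bounded_above[of "{..<num_threads P}" "\<lambda>t. card (thread_block P t)"]
    by (simp add: thread_data_size_def card_thread_block)
  finally have threads: "card ?threads \<le> thread_data_size P" .
  have "card ?rows \<le> (\<Sum>i\<in>saved_rows P p. card (old_row_block P i))"
    using card_saved_rows[OF assms] by (intro card_UN_le)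
  also have "\<dots> \<le> card (saved_rows P p) * core_len P"
    using sum_bounded_above[of "saved_rows P p" "\<lambda>i. card (old_row_block P i)" "core_len P"]
    by (simp add: card_old_row_block)
  \<comment> \<open>At most \<open>card (observed P)\<close> rows are saved, and
    \<open>J \<le> J ^ N\<close> because \<open>J\<close> and \<open>N\<close> are at least
    1.\<close>
  also have "\<dots> \<le> cache_table_size P"
    unfolding cache_table_size_def
    using assms card_saved_rows(2)[OF assms] power_increasing[of 1 "tensor_order P" "core_len P"]
    by (intro mult_le_mono) (auto simp: valid_input_def)
  finally have rows: "card ?rows \<le> cache_table_size P" .
  show "card (footprint P p) \<le> 2 * cache_table_size P + thread_data_size P"
    using threads rows card_cache_block(2)[OF assms]
      card_Un_le[of "cache_block P \<union> ?threads" ?rows] card_Un_le[of "cache_block P" ?threads]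
    unfolding footprint_def by linarith
qed

section \<open>Passage to the supremum over all executions\<close>

lemma memory_requirement_le:
  assumes "valid_input P"
  shows "memory_requirement P \<le> enat (2 * cache_table_size P + thread_data_size P)"
  unfolding memory_requirement_def
proof (rule SUP_least)
  fix s assume "s \<in> {s. (step P)\<^sup>*\<^sup>* (initial_state P) s}"
  then have sub: "dom (mem s) \<subseteq> footprint P (phase s)"
    using state_ok_reachable[OF assms] by (simp add: state_ok_def)
  moreover have "card (dom (mem s)) \<le> 2 * cache_table_size P + thread_data_size P"
    using card_mono[OF card_footprint(1)[OF assms] sub] card_footprint(2)[OF assms] by (rule order.trans)
  \<comment> \<open>Finiteness of the domain is needed too, as \<open>mem_size\<close> is infinite
    otherwise.\<close>
  ultimately show "mem_size (mem s) \<le> enat (2 * cache_table_size P + thread_data_size P)"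
    using card_footprint(1)[OF assms] by (auto simp: mem_size_def dest: finite_subset)
qed

theorem theorem6:
  fixes K :: nat
  shows "\<exists>C::nat. \<forall>P. valid_input P \<and> cache_dominates K P \<longrightarrow>
           memory_requirement P \<le> enat (C * (card (observed P) * core_len P ^ tensor_order P))"
\<comment> \<open>One table size pays for the cache, one for the old rows, and \<open>K\<close> for
  the data of the threads.\<close>
proof (intro exI[of _ "K + 2"] allI impI, elim conjE)
  fix P assume "valid_input P" "cache_dominates K P"
  then have "2 * cache_table_size P + thread_data_size P \<le> (K + 2) * cache_table_size P"
    by (simp add: cache_dominates_def)
  with memory_requirement_le[OF \<open>valid_input P\<close>]
  have "memory_requirement P \<le> enat ((K + 2) * cache_table_size P)"
    by (meson enat_ord_simps(1) order.trans)
  then show "memory_requirement P \<le> enat ((K + 2) * (card (observed P) * core_len P ^ tensor_order P))"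
    by (simp add: cache_table_size_def)
qed

end
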